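(* Let $u_0\in C^2([-d,d])$ with $(u_0'')_{\min}>0$, and let $\beta\in[0,(u_0'')_{\min})$. If $(u(x-ct,y),v(x-ct,y))$, with profile $(u,v)\in C^2(D_L)$ and wave speed $c\in\mathbb R$, is a traveling-wave solution of the $\beta$-plane equation in $D_L=\mathbb T_L\times[-d,d]$ with $v=0$ on $y=\pm d$, and $$\|\Delta u-u_0''\|_{C^0(D_L)}<(u_0'')_{\min}-\beta,$$ then $(u(x-ct,y),v(x-ct,y))$ is a shear flow.
   Context: Let $L,d>0$, $\mathbb T_L=\mathbb R/L\mathbb Z$, $D_L=\mathbb T_L\times[-d,d]$. For a constant $\beta\ge0$, the $\beta$-plane equation on $D_L$ is $$u_t+uu_x+vu_y-\beta yv=-P_x,\quad v_t+uv_x+vv_y+\beta yu=-P_y,\quad u_x+v_y=0,$$ with boundary condition $v=0$ on $y=\pm d$ ($P$ is the pressure). A traveling-wave solution of speed $c\in\mathbb R$ is a solution (for some pressure) of the form $(u(x-ct,y),v(x-ct,y))$; $(u,v)\in C^2(D_L)$ means that the profiles are $L$-periodic in the first variable and $C^2$ up to the boundary. It is a shear flow if $v\equiv0$ on $D_L$ (so that $u$ depends only on $y$). $(u_0'')_{\min}$ is the minimum of $u_0''$ on $[-d,d]$; $\|\cdot\|_{C^0}$ is the sup norm; $\Delta=\partial_x^2+\partial_y^2$. *)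

theory Defs
  imports "HOL-Analysis.Analysis"
begin

text \<open>
  A function on the channel \<open>D\<^sub>L = (\<real>/L\<int>) \<times> [-d,d]\<close> is represented by a curried
  function of type \<open>real \<Rightarrow> real \<Rightarrow> real\<close> that is \<open>L\<close>-periodic in its first argument for
  every value of the second argument in \<open>[-d,d]\<close>.  Its values for second arguments outside
  \<open>[-d,d]\<close> play no role: derivatives in the second variable are taken within \<open>[-d,d]\<close>, hence
  are one-sided at \<open>y = -d\<close> and \<open>y = d\<close>.
\<close>

definition strip :: "real \<Rightarrow> (real \<times> real) set" where
  "strip d = UNIV \<times> {-d..d}"

definition x_periodic :: "real \<Rightarrow> real \<Rightarrow> (real \<Rightarrow> real \<Rightarrow> real) \<Rightarrow> bool" where
  "x_periodic L d f \<longleftrightarrow> (\<forall>x. \<forall>y\<in>{-d..d}. f (x + L) y = f x y)"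

definition deriv_seg :: "real \<Rightarrow> (real \<Rightarrow> real) \<Rightarrow> real \<Rightarrow> real" where
  "deriv_seg d g y = vector_derivative g (at y within {-d..d})"

definition dx :: "(real \<Rightarrow> real \<Rightarrow> real) \<Rightarrow> real \<Rightarrow> real \<Rightarrow> real" where
  "dx f x y = deriv (\<lambda>s. f s y) x"

definition dy :: "real \<Rightarrow> (real \<Rightarrow> real \<Rightarrow> real) \<Rightarrow> real \<Rightarrow> real \<Rightarrow> real" where
  "dy d f x y = deriv_seg d (\<lambda>s. f x s) y"

definition dt :: "(real \<Rightarrow> real \<Rightarrow> real \<Rightarrow> real) \<Rightarrow> real \<Rightarrow> real \<Rightarrow> real \<Rightarrow> real" where
  "dt F t x y = deriv (\<lambda>s. F s x y) t"

definition laplacian :: "real \<Rightarrow> (real \<Rightarrow> real \<Rightarrow> real) \<Rightarrow> real \<Rightarrow> real \<Rightarrow> real" where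
  "laplacian d f x y = dx (dx f) x y + dy d (dy d f) x y"

text \<open>
  \<open>deriv\<close> and \<open>vector_derivative\<close> are total, so existence of derivatives is always required
  separately, by the following predicates.
\<close>

definition has_partials :: "real \<Rightarrow> (real \<Rightarrow> real \<Rightarrow> real) \<Rightarrow> bool" where
  "has_partials d f \<longleftrightarrow>
     (\<forall>x. \<forall>y\<in>{-d..d}. (\<lambda>s. f s y) differentiable (at x) \<and>
                      (\<lambda>s. f x s) differentiable (at y within {-d..d}))"

definition C1_strip :: "real \<Rightarrow> (real \<Rightarrow> real \<Rightarrow> real) \<Rightarrow> bool" where
  "C1_strip d f \<longleftrightarrow> has_partials d f \<and>
     continuous_on (strip d) (\<lambda>(x, y). f x y) \<and>
     continuous_on (strip d) (\<lambda>(x, y). dx f x y) \<and>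
     continuous_on (strip d) (\<lambda>(x, y). dy d f x y)"

definition C2_channel :: "real \<Rightarrow> real \<Rightarrow> (real \<Rightarrow> real \<Rightarrow> real) \<Rightarrow> bool" where
  "C2_channel L d f \<longleftrightarrow>
     x_periodic L d f \<and> C1_strip d f \<and> C1_strip d (dx f) \<and> C1_strip d (dy d f)"

definition C2_seg :: "real \<Rightarrow> (real \<Rightarrow> real) \<Rightarrow> bool" where
  "C2_seg d g \<longleftrightarrow> g differentiable_on {-d..d} \<and> deriv_seg d g differentiable_on {-d..d} \<and>
     continuous_on {-d..d} (deriv_seg d (deriv_seg d g))"

text \<open>
  These are used for a continuous function on the compact interval, respectively a continuous
  and \<open>x\<close>-periodic (hence bounded) function, so the infimum is attained and the supremum is
  finite.
\<close>

definition seg_min :: "real \<Rightarrow> (real \<Rightarrow> real) \<Rightarrow> real" where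
  "seg_min d g = (INF y\<in>{-d..d}. g y)"

definition C0_norm :: "real \<Rightarrow> (real \<Rightarrow> real \<Rightarrow> real) \<Rightarrow> real" where
  "C0_norm d f = (SUP (x, y)\<in>strip d. \<bar>f x y\<bar>)"

text \<open>
  Time-dependent fields \<open>U, V, P\<close> take the arguments \<open>t x y\<close>.  The pressure is a function on
  \<open>D\<^sub>L\<close> at each time, hence periodic too; only the existence of its spatial partial
  derivatives is required (the equations determine their regularity).
\<close>

definition beta_plane_solution_with_pressure ::
  "real \<Rightarrow> real \<Rightarrow> real \<Rightarrow> (real \<Rightarrow> real \<Rightarrow> real \<Rightarrow> real) \<Rightarrow>
   (real \<Rightarrow> real \<Rightarrow> real \<Rightarrow> real) \<Rightarrow> (real \<Rightarrow> real \<Rightarrow> real \<Rightarrow> real) \<Rightarrow> bool" where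
  "beta_plane_solution_with_pressure L d \<beta> U V P \<longleftrightarrow>
     (\<forall>t. x_periodic L d (U t) \<and> x_periodic L d (V t) \<and> x_periodic L d (P t)) \<and>
     (\<forall>t. has_partials d (U t) \<and> has_partials d (V t) \<and> has_partials d (P t)) \<and>
     (\<forall>t x. \<forall>y\<in>{-d..d}. (\<lambda>s. U s x y) differentiable (at t) \<and>
                        (\<lambda>s. V s x y) differentiable (at t)) \<and>
     (\<forall>t x. \<forall>y\<in>{-d..d}.
        dt U t x y + U t x y * dx (U t) x y + V t x y * dy d (U t) x y - \<beta> * y * V t x y
          = - dx (P t) x y \<and>
        dt V t x y + U t x y * dx (V t) x y + V t x y * dy d (V t) x y + \<beta> * y * U t x y
          = - dy d (P t) x y \<and>
        dx (U t) x y + dy d (V t) x y = 0) \<and>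
     (\<forall>t x. V t x (-d) = 0 \<and> V t x d = 0)"

definition beta_plane_solution ::
  "real \<Rightarrow> real \<Rightarrow> real \<Rightarrow> (real \<Rightarrow> real \<Rightarrow> real \<Rightarrow> real) \<Rightarrow>
   (real \<Rightarrow> real \<Rightarrow> real \<Rightarrow> real) \<Rightarrow> bool" where
  "beta_plane_solution L d \<beta> U V \<longleftrightarrow>
     (\<exists>P. beta_plane_solution_with_pressure L d \<beta> U V P)"

definition traveling :: "real \<Rightarrow> (real \<Rightarrow> real \<Rightarrow> real) \<Rightarrow> real \<Rightarrow> real \<Rightarrow> real \<Rightarrow> real" where
  "traveling c f t x y = f (x - c * t) y"

text \<open>
  A flow is shear iff its second component vanishes identically; incompressibility then makes
  the first component a function of \<open>y\<close> alone, so \<open>U\<close> is not constrained further.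
\<close>

definition shear_flow ::
  "real \<Rightarrow> (real \<Rightarrow> real \<Rightarrow> real \<Rightarrow> real) \<Rightarrow> (real \<Rightarrow> real \<Rightarrow> real \<Rightarrow> real) \<Rightarrow> bool" where
  "shear_flow d U V \<longleftrightarrow> (\<forall>t x. \<forall>y\<in>{-d..d}. V t x y = 0)"

end

theory Submission
  imports Defs
begin

text \<open>
  Put \<open>w = u - c\<close>. The hypothesis on \<open>\<Delta>u\<close> gives \<open>\<Delta>w - \<beta> \<ge> \<gamma> > 0\<close>, and the curl of the momentum
  equations is \<open>w \<Delta>v = v (\<Delta>w - \<beta>)\<close>. Where \<open>w > 0\<close> a positive maximum or negative minimum of \<open>v\<close>
  would contradict this equation, so \<open>v = 0\<close> on \<open>{w \<ge> 0}\<close>; moreover \<open>\<bar>v\<bar> \<le> C \<bar>w\<bar>\<close>.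
  On \<open>{w < 0}\<close> the function \<open>-w\<close> is a positive supersolution of the linear equation solved by \<open>v\<close>:
  with \<open>H = 1 / (\<epsilon> - w)\<close>,
  \<open>div (v \<nabla>v + v\<^sup>2 H \<nabla>w) = \<bar>\<nabla>v + v H \<nabla>w\<bar>\<^sup>2 + v \<Delta>v + v\<^sup>2 H \<Delta>w\<close>, where the last two terms add up to
  at least \<open>-O(\<epsilon>)\<close>. Hence \<open>w \<nabla>v - v \<nabla>w\<close> is small in mean square.
  On the other hand incompressibility yields
  \<open>div (y w v, y v\<^sup>2) = v\<^sup>2 + y (w v\<^sub>x - v w\<^sub>x)\<close>. Adding \<open>1/\<delta>\<close> times the first field, with
  \<open>\<epsilon> = \<delta>\<^sup>2\<close>, to the second gives a divergence that is at least \<open>v\<^sup>2 - K \<delta>\<close> pointwise, and whose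
  integral vanishes by periodicity and the boundary condition. Let \<open>\<delta> \<rightarrow> 0\<close>.
\<close>

subsection \<open>Partial derivatives on the strip\<close>

text \<open>Derivatives within the segment are unique, also at the walls, because
  \<open>d > 0\<close> makes each of its points an accumulation point.\<close>

lemma deriv_seg_eqI:
  assumes "y \<in> {-d..d}" and "d > 0"
    and "(g has_real_derivative g') (at y within {-d..d})"
  shows "deriv_seg d g y = g'"
  using assms vector_derivative_within_closed_interval[of "-d" d y g g']
  by (simp add: deriv_seg_def has_real_derivative_iff_has_vector_derivative)

lemma has_partials_dx:
  assumes "has_partials d f" and "y \<in> {-d..d}"
  shows "((\<lambda>s. f s y) has_real_derivative dx f x y) (at x)"
  using assms unfolding has_partials_def dx_def
  by (simp add: DERIV_deriv_iff_real_differentiable)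

lemma has_partials_dy:
  assumes "has_partials d f" and "y \<in> {-d..d}"
  shows "((\<lambda>s. f x s) has_real_derivative dy d f x y) (at y within {-d..d})"
  using assms unfolding has_partials_def dy_def deriv_seg_def
  by (simp add: has_real_derivative_iff_has_vector_derivative vector_derivative_works)

lemma C1_strip_continuous:
  assumes "C1_strip d f"
  shows "continuous_on (strip d) (\<lambda>z. f (fst z) (snd z))"
    and "continuous_on (strip d) (\<lambda>z. dx f (fst z) (snd z))"
    and "continuous_on (strip d) (\<lambda>z. dy d f (fst z) (snd z))"
  using assms by (simp_all add: C1_strip_def case_prod_beta)

text \<open>A derivative within the segment sees only values on the segment. The separate base
  points \<open>x\<close> and \<open>x'\<close> allow for a shift by one period.\<close>

lemma dy_cong_strip:
  assumes "y \<in> {-d..d}" and "d > 0" and "has_partials d f"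
    and "\<And>y. y \<in> {-d..d} \<Longrightarrow> f x y = g x' y"
  shows "dy d g x' y = dy d f x y"
proof -
  have "((\<lambda>s. g x' s) has_real_derivative dy d f x y) (at y within {-d..d})"
    by (rule has_field_derivative_transform_within[OF has_partials_dy[OF assms(3,1)] zero_less_one])
      (use assms in auto)
  then show ?thesis
    using deriv_seg_eqI[OF assms(1,2)] by (simp add: dy_def[of d g])
qed

section \<open>Periodicity in the first variable\<close>

lemma x_periodic_dx:
  assumes "x_periodic L d f"
  shows "x_periodic L d (dx f)"
  unfolding x_periodic_def
proof (intro allI ballI)
  fix x y assume y: "y \<in> {-d..d}"
  have "(\<lambda>s. f (s + L) y) = (\<lambda>s. f s y)"
    using assms y by (auto simp: x_periodic_def)
  then have "((\<lambda>s. f s y) has_field_derivative l) (at (x + L)) \<longleftrightarrow>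
             ((\<lambda>s. f s y) has_field_derivative l) (at x)" for l
    using DERIV_shift[of "\<lambda>s. f s y" l x L] by simp
  then show "dx f (x + L) y = dx f x y"
    by (simp add: dx_def deriv_def)
qed

lemma x_periodic_dy:
  assumes "x_periodic L d f" and "has_partials d f" and "d > 0"
  shows "x_periodic L d (dy d f)"
  unfolding x_periodic_def
  using assms by (auto intro!: dy_cong_strip simp: x_periodic_def)

text \<open>The representative is chosen before the function, so one shift moves relations between
  several periodic functions into the same compact period.\<close>

lemma x_periodic_reduce:
  assumes "L > 0"
  obtains x' where "x' \<in> {0..L}"
    and "\<And>f y. x_periodic L d f \<Longrightarrow> y \<in> {-d..d} \<Longrightarrow> f x y = f x' y"
proof
  define x' where "x' = x + of_int (- \<lfloor>x / L\<rfloor>) * L"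
  have "\<lfloor>x / L\<rfloor> * L \<le> x" "x < (\<lfloor>x / L\<rfloor> + 1) * L"
    using assms by (simp_all flip: pos_le_divide_eq pos_divide_less_eq)
  then show "x' \<in> {0..L}"
    by (simp add: x'_def algebra_simps)
  fix f y assume "x_periodic L d f" and "y \<in> {-d..d}"
  then interpret periodic_fun_simple "\<lambda>x. f x y" L
    by unfold_locales (simp add: x_periodic_def)
  show "f x y = f x' y"
    unfolding x'_def by (rule plus_of_int[symmetric])
qed

section \<open>Symmetry of mixed partial derivatives\<close>

text \<open>The mean value theorem is applied first to \<open>P s e - P s c\<close> as a function of
  \<open>s\<close>, then to \<open>p x\<close> at the point \<open>x\<close> so found.\<close>

lemma second_difference_mvt:
  fixes P :: "real \<Rightarrow> real \<Rightarrow> real"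
  assumes "a < b" and "c < e"
    and p: "\<And>x y. x \<in> {a..b} \<Longrightarrow> y \<in> {c..e} \<Longrightarrow>
              ((\<lambda>s. P s y) has_real_derivative p x y) (at x within {a..b})"
    and r: "\<And>x y. x \<in> {a..b} \<Longrightarrow> y \<in> {c..e} \<Longrightarrow>
              ((\<lambda>s. p x s) has_real_derivative r x y) (at y within {c..e})"
  shows "\<exists>x\<in>{a..b}. \<exists>y\<in>{c..e}. P b e - P b c - P a e + P a c = r x y * (b - a) * (e - c)"
proof -
  have "((\<lambda>s. P s e - P s c) has_derivative (\<lambda>h. h * (p x e - p x c))) (at x within {a..b})"
    if "a \<le> x" "x \<le> b" for x
    using DERIV_diff[OF p[of x e] p[of x c]] that \<open>c < e\<close>
    by (simp add: has_field_derivative_def mult.commute[of _ "_ - _"])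
  from mvt_simple[OF \<open>a < b\<close> this]
  obtain x where x: "x \<in> {a<..<b}" "P b e - P b c - (P a e - P a c) = (b - a) * (p x e - p x c)"
    by auto
  have "((\<lambda>s. p x s) has_derivative (\<lambda>h. h * r x y)) (at y within {c..e})"
    if "c \<le> y" "y \<le> e" for y
    using r[of x y] that x by (simp add: has_field_derivative_def mult.commute[of _ "r _ _"])
  from mvt_simple[OF \<open>c < e\<close> this]
  obtain y where y: "y \<in> {c<..<e}" "p x e - p x c = (e - c) * r x y"
    by auto
  then have "P b e - P b c - P a e + P a c = r x y * (b - a) * (e - c)"
    using x(2)[unfolded y(2)] by (simp add: algebra_simps)
  with x(1) y(1) show ?thesis by force
qed

text \<open>
  \<open>P\<close> plays the role of the pressure, which is only known to have first partial derivatives;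
  hence no regularity of \<open>P\<close> itself is assumed.
\<close>

lemma mixed_partials_eq:
  fixes P :: "real \<Rightarrow> real \<Rightarrow> real"
  assumes "d > 0"
    and Px: "\<And>x y. y \<in> {-d..d} \<Longrightarrow> ((\<lambda>s. P s y) has_real_derivative p x y) (at x)"
    and Py: "\<And>x y. y \<in> {-d..d} \<Longrightarrow> ((\<lambda>s. P x s) has_real_derivative q x y) (at y within {-d..d})"
    and py: "\<And>x y. y \<in> {-d..d} \<Longrightarrow> ((\<lambda>s. p x s) has_real_derivative p' x y) (at y within {-d..d})"
    and qx: "\<And>x y. y \<in> {-d..d} \<Longrightarrow> ((\<lambda>s. q s y) has_real_derivative q' x y) (at x)"
    and cont: "continuous_on (strip d) (\<lambda>z. p' (fst z) (snd z))"
      "continuous_on (strip d) (\<lambda>z. q' (fst z) (snd z))"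
    and y: "y \<in> {-d..d}"
  shows "p' x y = q' x y"
proof (rule ccontr)
  \<comment> \<open>With half the gap as tolerance, a value of \<open>p'\<close> and a value of
    \<open>q'\<close> taken near \<open>(x, y)\<close> cannot coincide.\<close>
  define e where "e = \<bar>p' x y - q' x y\<bar> / 2"
  assume "p' x y \<noteq> q' x y"
  then have "e > 0" by (simp add: e_def)
  have xy: "(x, y) \<in> strip d" using y by (simp add: strip_def)
  obtain r1 where r1: "r1 > 0"
    "\<And>z. z \<in> strip d \<Longrightarrow> dist z (x, y) < r1 \<Longrightarrow> \<bar>p' (fst z) (snd z) - p' x y\<bar> < e"
    using cont(1) xy \<open>e > 0\<close> unfolding continuous_on_iff dist_real_def by fastforce
  obtain r2 where r2: "r2 > 0"
    "\<And>z. z \<in> strip d \<Longrightarrow> dist z (x, y) < r2 \<Longrightarrow> \<bar>q' (fst z) (snd z) - q' x y\<bar> < e"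
    using cont(2) xy \<open>e > 0\<close> unfolding continuous_on_iff dist_real_def by fastforce
  \<comment> \<open>Points of the square are at distance at most \<open>2 * h\<close> from
    \<open>(x, y)\<close>, hence the division by 3. The bound by \<open>d\<close> lets a segment of
    length \<open>h\<close> fit on one side of \<open>y\<close>.\<close>
  define h where "h = min d (min r1 r2 / 3)"
  have h: "0 < h" "h \<le> d" "3 * h \<le> r1" "3 * h \<le> r2"
    using r1 r2 \<open>d > 0\<close> by (auto simp: h_def)
  \<comment> \<open>The square extends from \<open>y\<close> towards the centre line, so it stays in
    the strip even when \<open>y\<close> is on a wall.\<close>
  define c where "c = (if y \<le> 0 then y else y - h)"
  have c: "y \<in> {c..c+h}" "{c..c+h} \<subseteq> {-d..d}"
    using h y by (auto simp: c_def)
  have near: "(s, t) \<in> strip d" "dist (s, t) (x, y) < r1" "dist (s, t) (x, y) < r2"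
    if "s \<in> {x..x+h}" "t \<in> {c..c+h}" for s t
  proof -
    have "dist (s, t) (x, y) \<le> dist (s, t) (x, t) + dist (x, t) (x, y)"
      by (rule dist_triangle)
    also have "\<dots> = \<bar>s - x\<bar> + \<bar>t - y\<bar>" by (simp add: dist_Pair_Pair dist_real_def)
    also have "\<dots> \<le> 2 * h" using that c(1) by auto
    finally show "dist (s, t) (x, y) < r1" "dist (s, t) (x, y) < r2" using h by auto
    show "(s, t) \<in> strip d" using that c by (auto simp: strip_def)
  qed
  \<comment> \<open>One and the same second difference is evaluated in the two orders of
    differentiation.\<close>
  have "\<exists>s\<in>{x..x+h}. \<exists>t\<in>{c..c+h}.
      P (x + h) (c + h) - P (x + h) c - P x (c + h) + P x c = p' s t * (x + h - x) * (c + h - c)"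
    by (rule second_difference_mvt[where p = p])
      (use h c in \<open>auto intro: has_field_derivative_at_within[OF Px] DERIV_subset[OF py]\<close>)
  then obtain s t where st: "s \<in> {x..x+h}" "t \<in> {c..c+h}"
    "P (x + h) (c + h) - P (x + h) c - P x (c + h) + P x c = p' s t * h * h"
    by auto
  have "\<exists>t\<in>{c..c+h}. \<exists>s\<in>{x..x+h}.
      P (x + h) (c + h) - P x (c + h) - P (x + h) c + P x c = q' s t * (c + h - c) * (x + h - x)"
    by (rule second_difference_mvt[where p = "\<lambda>y x. q x y" and P = "\<lambda>y x. P x y"])
      (use h c in \<open>auto intro: has_field_derivative_at_within[OF qx] DERIV_subset[OF Py]\<close>)
  then obtain s' t' where st': "s' \<in> {x..x+h}" "t' \<in> {c..c+h}"
    "P (x + h) (c + h) - P x (c + h) - P (x + h) c + P x c = q' s' t' * h * h"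
    by auto
  have "p' s t * h * h = q' s' t' * h * h" using st(3) st'(3) by linarith
  then have "p' s t = q' s' t'" using h by simp
  moreover have "\<bar>p' s t - p' x y\<bar> < e" "\<bar>q' s' t' - q' x y\<bar> < e"
    using r1(2)[OF near(1,2)[OF st(1,2)]] r2(2)[OF near(1,3)[OF st'(1,2)]] by auto
  ultimately show False by (smt (verit) e_def field_sum_of_halves)
qed

section \<open>Divergence theorem on one period\<close>

text \<open>By Fubini each summand is integrated first in its own variable, where the fundamental
  theorem of calculus leaves a difference of boundary values that is zero.\<close>

lemma integral_divergence_zero:
  fixes F1 F2 :: "real \<Rightarrow> real \<Rightarrow> real"
  assumes "L > 0" and "d > 0"
    and F1: "\<And>x y. y \<in> {-d..d} \<Longrightarrow> ((\<lambda>s. F1 s y) has_real_derivative G1 x y) (at x)"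
    and F2: "\<And>x y. y \<in> {-d..d} \<Longrightarrow>
               ((\<lambda>s. F2 x s) has_real_derivative G2 x y) (at y within {-d..d})"
    and cont: "continuous_on (strip d) (\<lambda>z. G1 (fst z) (snd z))"
      "continuous_on (strip d) (\<lambda>z. G2 (fst z) (snd z))"
    and per: "\<And>y. y \<in> {-d..d} \<Longrightarrow> F1 L y = F1 0 y"
    and bdry: "\<And>x. F2 x (-d) = F2 x d"
  shows "((\<lambda>z. G1 (fst z) (snd z) + G2 (fst z) (snd z)) has_integral 0) (cbox (0, -d) (L, d))"
proof -
  let ?R = "cbox (0, -d) (L, d)"
  have sub: "?R \<subseteq> strip d" by (auto simp: strip_def cbox_Pair_iff)
  note c = cont[THEN continuous_on_subset, OF sub]
  have "integral ?R (\<lambda>z. G2 (fst z) (snd z)) =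
        integral {0..L} (\<lambda>x. integral {-d..d} (\<lambda>y. G2 x y))"
    using integral_prod_continuous[OF c(2)] by simp
  also have "\<dots> = integral {0..L} (\<lambda>x. 0)"
  proof (rule integral_cong)
    fix x
    have "(G2 x has_integral F2 x d - F2 x (-d)) {-d..d}"
      using F2 \<open>d > 0\<close> by (intro fundamental_theorem_of_calculus)
        (auto simp: has_real_derivative_iff_has_vector_derivative)
    then show "integral {-d..d} (\<lambda>y. G2 x y) = 0"
      using bdry by (simp add: integral_unique)
  qed
  finally have 2: "integral ?R (\<lambda>z. G2 (fst z) (snd z)) = 0" by simp
  have "integral ?R (\<lambda>z. G1 (fst z) (snd z)) =
        integral {0..L} (\<lambda>x. integral {-d..d} (\<lambda>y. G1 x y))"
    using integral_prod_continuous[OF c(1)] by simp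
  also have "\<dots> = integral {-d..d} (\<lambda>y. integral {0..L} (\<lambda>x. G1 x y))"
    using integral_swap_continuous[of 0 "-d" L d G1] c(1) by (simp add: case_prod_beta)
  also have "\<dots> = integral {-d..d} (\<lambda>y. 0)"
  proof (rule integral_cong)
    fix y assume "y \<in> {-d..d}"
    then have "((\<lambda>x. G1 x y) has_integral F1 L y - F1 0 y) {0..L}"
      using F1 \<open>L > 0\<close> by (intro fundamental_theorem_of_calculus)
        (auto simp: has_real_derivative_iff_has_vector_derivative[symmetric]
          intro: has_field_derivative_at_within)
    then show "integral {0..L} (\<lambda>x. G1 x y) = 0"
      using per \<open>y \<in> {-d..d}\<close> by (simp add: integral_unique)
  qed
  finally have 1: "integral ?R (\<lambda>z. G1 (fst z) (snd z)) = 0" by simp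
  show ?thesis
    using has_integral_add[OF integrable_continuous[OF c(1), THEN integrable_integral]
        integrable_continuous[OF c(2), THEN integrable_integral]] 1 2 by simp
qed

text \<open>At the maximum \<open>f'\<close> vanishes. If \<open>l\<close> were positive,
  \<open>f'\<close> would be positive just to the right, and \<open>f\<close> would exceed its
  maximum there.\<close>

lemma second_derivative_nonpos_at_local_max:
  fixes f :: "real \<Rightarrow> real"
  assumes "r > 0" and max: "\<And>s. \<bar>x - s\<bar> < r \<Longrightarrow> f s \<le> f x"
    and f': "\<And>s. \<bar>x - s\<bar> < r \<Longrightarrow> (f has_real_derivative f' s) (at s)"
    and f'': "(f' has_real_derivative l) (at x)"
  shows "l \<le> 0"
proof (rule ccontr)
  assume "\<not> l \<le> 0"
  have "f' x = 0"
    using DERIV_local_max[OF f'[of x], of r] max \<open>r > 0\<close> by auto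
  obtain e where e: "e > 0" "\<And>h. 0 < h \<Longrightarrow> h < e \<Longrightarrow> 0 < f' (x + h)"
    using DERIV_pos_inc_right[OF f''] \<open>\<not> l \<le> 0\<close> \<open>f' x = 0\<close> by auto
  define h where "h = min r e / 2"
  have h: "0 < h" "h < r" "h < e" using e \<open>r > 0\<close> by (auto simp: h_def)
  obtain z where z: "x < z" "z < x + h" "f (x + h) - f x = (x + h - x) * f' z"
    using MVT2[of x "x + h" f f'] f' h by force
  then have "f (x + h) > f x"
    using mult_pos_pos[OF h(1) e(2)[of "z - x"]] h by simp
  with max[of "x + h"] h show False by simp
qed

text \<open>
  \<open>H' = H\<^sup>2\<close> is what completes the square in the energy identity. Positive arguments only occur
  where \<open>v\<close> vanishes, so there any \<open>C\<^sup>1\<close> extension will do.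
\<close>

lemma C1_reciprocal_extension:
  fixes e :: real
  assumes "e > 0"
  obtains H H' :: "real \<Rightarrow> real"
  where "\<And>s. (H has_real_derivative H' s) (at s)" and "continuous_on UNIV H'"
    and "\<And>s. s \<le> 0 \<Longrightarrow> H s = 1 / (e - s)" and "\<And>s. s \<le> 0 \<Longrightarrow> H' s = (H s)\<^sup>2"
proof
  \<comment> \<open>For positive \<open>s\<close> the reciprocal is continued by its tangent line at
    0, with value \<open>1 / e\<close> and slope \<open>1 / e\<^sup>2\<close>.\<close>
  define H where "H s = (if s \<in> {..0} then 1 / (e - s) else 1 / e + s / e\<^sup>2)" for s
  define H' where "H' s = 1 / (e - min s 0)\<^sup>2" for s
  show "H s = 1 / (e - s)" if "s \<le> 0" for s using that by (simp add: H_def)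
  show "H' s = (H s)\<^sup>2" if "s \<le> 0" for s using that by (simp add: H_def H'_def power_divide)
  show "continuous_on UNIV H'"
    unfolding H'_def using assms by (intro continuous_intros) auto
  show "(H has_real_derivative H' s) (at s)" for s
  proof -
    have "((\<lambda>s. if s \<in> {..0} then 1 / (e - s) else 1 / e + s / e\<^sup>2) has_vector_derivative
        (if s \<in> {..0} then 1 / (e - s)\<^sup>2 else 1 / e\<^sup>2)) (at s within UNIV)"
      using assms
      by (intro has_vector_derivative_If_within_closures[where S = "{..0}" and T = "{0<..}"])
        (auto simp flip: has_real_derivative_iff_has_vector_derivative
          simp: power2_eq_square divide_simps intro!: derivative_eq_intros)
    also have "(if s \<in> {..0} then 1 / (e - s)\<^sup>2 else 1 / e\<^sup>2) = H' s"
      by (auto simp: H'_def min_def)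
    finally show ?thesis
      by (simp add: H_def[abs_def] has_real_derivative_iff_has_vector_derivative)
  qed
qed

subsection \<open>The vorticity equation\<close>

text \<open>Time 0 suffices for the profile equations, since there the travelling field equals its
  profile.\<close>

lemma deriv_traveling_0:
  assumes "has_partials d f" and "y \<in> {-d..d}"
  shows "dt (traveling c f) 0 x y = - c * dx f x y"
proof -
  have "((\<lambda>s. f (x - c * s) y) has_real_derivative dx f x y * (- c)) (at 0)"
    by (rule DERIV_chain2[where f = "\<lambda>s. f s y"])
      (use has_partials_dx[OF assms, of x] in \<open>auto intro!: derivative_eq_intros\<close>)
  then show ?thesis
    by (simp add: dt_def traveling_def DERIV_imp_deriv)
qed

text \<open>The second claim is the equality of the two mixed derivatives of the pressure, rewritten
  by incompressibility.\<close>

lemma traveling_wave_vorticity: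
  assumes "d > 0" and u: "C2_channel L d u" and v: "C2_channel L d v"
    and sol: "beta_plane_solution L d \<beta> (traveling c u) (traveling c v)"
  shows "\<And>x y. y \<in> {-d..d} \<Longrightarrow> dx u x y + dy d v x y = 0"
    and "\<And>x y. y \<in> {-d..d} \<Longrightarrow>
           (u x y - c) * laplacian d v x y = v x y * (laplacian d u x y - \<beta>)"
    and "\<And>x. v x (-d) = 0 \<and> v x d = 0"
proof -
  obtain P where P: "beta_plane_solution_with_pressure L d \<beta> (traveling c u) (traveling c v) P"
    using sol by (auto simp: beta_plane_solution_def)
  have Cu: "C1_strip d u" "C1_strip d (dx u)" "C1_strip d (dy d u)"
    and Cv: "C1_strip d v" "C1_strip d (dx v)" "C1_strip d (dy d v)"
    using u v by (auto simp: C2_channel_def)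
  have hp: "has_partials d u" "has_partials d (dx u)" "has_partials d (dy d u)"
    "has_partials d v" "has_partials d (dx v)" "has_partials d (dy d v)"
    using Cu Cv by (auto simp: C1_strip_def)
  have t0: "traveling c f 0 = f" for f by (intro ext) (simp add: traveling_def)
  show div: "dx u x y + dy d v x y = 0" if "y \<in> {-d..d}" for x y
    using P that unfolding beta_plane_solution_with_pressure_def by (metis t0)
  have div': "dy d v x y = - dx u x y" if "y \<in> {-d..d}" for x y
    using div[OF that, of x] by linarith
  show "v x (-d) = 0 \<and> v x d = 0" for x
    using P unfolding beta_plane_solution_with_pressure_def by (metis t0)
  \<comment> \<open>\<open>(p, q)\<close> is the pressure gradient at time 0. The time derivative
    contributes \<open>- c\<close> times the \<open>x\<close>-derivative, which turns the advecting
    speed \<open>u\<close> into \<open>u - c\<close>.\<close>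
  define p where "p x y = - ((u x y - c) * dx u x y + v x y * dy d u x y - \<beta> * y * v x y)" for x y
  define q where "q x y = - ((u x y - c) * dx v x y + v x y * dy d v x y + \<beta> * y * u x y)" for x y
  have hP: "has_partials d (P 0)"
    using P unfolding beta_plane_solution_with_pressure_def by blast
  have "dt (traveling c u) 0 x y + u x y * dx u x y + v x y * dy d u x y - \<beta> * y * v x y
          = - dx (P 0) x y \<and>
        dt (traveling c v) 0 x y + u x y * dx v x y + v x y * dy d v x y + \<beta> * y * u x y
          = - dy d (P 0) x y" if "y \<in> {-d..d}" for x y
    using P that unfolding beta_plane_solution_with_pressure_def by (metis t0)
  then have pq: "dx (P 0) x y = p x y" "dy d (P 0) x y = q x y" if "y \<in> {-d..d}" for x y
    using that hp deriv_traveling_0 by (fastforce simp: p_def q_def algebra_simps)+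
  note D = hp(1,2,3,4,5,6)[THEN has_partials_dx] hp(1,2,3,4,5,6)[THEN has_partials_dy]
  define p' where "p' x y = - (dy d u x y * dx u x y + (u x y - c) * dy d (dx u) x y
      + dy d v x y * dy d u x y + v x y * dy d (dy d u) x y - \<beta> * v x y - \<beta> * y * dy d v x y)" for x y
  define q' where "q' x y = - (dx u x y * dx v x y + (u x y - c) * dx (dx v) x y
      + dx v x y * dy d v x y + v x y * dx (dy d v) x y + \<beta> * y * dx u x y)" for x y
  note C = Cu[THEN C1_strip_continuous(1)] Cu[THEN C1_strip_continuous(2)]
    Cu[THEN C1_strip_continuous(3)] Cv[THEN C1_strip_continuous(1)]
    Cv[THEN C1_strip_continuous(2)] Cv[THEN C1_strip_continuous(3)]
  have "p' x y = q' x y" if y: "y \<in> {-d..d}" for x y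
  proof (rule mixed_partials_eq[where P = "P 0" and p = p and q = q and p' = p' and q' = q', OF \<open>d > 0\<close> _ _ _ _ _ _ y])
    fix x y assume y: "y \<in> {-d..d}"
    show "((\<lambda>s. P 0 s y) has_real_derivative p x y) (at x)"
      using has_partials_dx[OF hP y, of x] unfolding pq(1)[OF y] .
    show "((\<lambda>s. P 0 x s) has_real_derivative q x y) (at y within {-d..d})"
      using has_partials_dy[OF hP y, of x] unfolding pq(2)[OF y] .
    show "(p x has_real_derivative p' x y) (at y within {-d..d})"
      unfolding p_def[abs_def] p'_def using y
      by (auto intro!: derivative_eq_intros D simp: algebra_simps)
    show "((\<lambda>s. q s y) has_real_derivative q' x y) (at x)"
      unfolding q_def q'_def using y
      by (auto intro!: derivative_eq_intros D simp: algebra_simps)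
  next
    show "continuous_on (strip d) (\<lambda>z. p' (fst z) (snd z))"
      unfolding p'_def by (intro continuous_intros C)
    show "continuous_on (strip d) (\<lambda>z. q' (fst z) (snd z))"
      unfolding q'_def by (intro continuous_intros C)
  qed
  \<comment> \<open>Differentiating the divergence equation replaces both mixed derivatives by pure
    second derivatives, which then form the two Laplacians.\<close>
  moreover have "dy d (dx u) x y = - dy d (dy d v) x y" if "y \<in> {-d..d}" for x y
  proof -
    have "((\<lambda>s. - dx u x s) has_real_derivative - dy d (dx u) x y) (at y within {-d..d})"
      using D(8)[OF that] by (rule DERIV_minus)
    then have "((\<lambda>s. dy d v x s) has_real_derivative - dy d (dx u) x y) (at y within {-d..d})"
      by (rule has_field_derivative_transform_within[OF _ zero_less_one])
        (use that div' in auto)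
    then show ?thesis
      using deriv_seg_eqI[OF that \<open>d > 0\<close>] by (simp add: dy_def[of d "dy d v"])
  qed
  moreover have "dx (dy d v) x y = - dx (dx u) x y" if "y \<in> {-d..d}" for x y
  proof -
    have "(\<lambda>s. dy d v s y) = (\<lambda>s. - dx u s y)"
      using div'[OF that] by auto
    then show ?thesis
      using DERIV_minus[OF D(2)[OF that]] by (simp add: dx_def[of "dy d v"] DERIV_imp_deriv)
  qed
  moreover note div'
  \<comment> \<open>Products of first derivatives cancel because \<open>dx u + dy d v\<close>
    factors out of each pair. The terms carrying \<open>\<beta> * y\<close> cancel for the same
    reason.\<close>
  ultimately have "(u x y - c) * (- dy d (dy d v) x y) + v x y * dy d (dy d u) x y - \<beta> * v x y
     = (u x y - c) * dx (dx v) x y + v x y * (- dx (dx u) x y)" if "y \<in> {-d..d}" for x y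
    using that unfolding p'_def q'_def by (simp add: algebra_simps)
  then show "(u x y - c) * laplacian d v x y = v x y * (laplacian d u x y - \<beta>)"
    if "y \<in> {-d..d}" for x y
    using that by (simp add: laplacian_def algebra_simps)
qed

section \<open>Maximum principle\<close>

text \<open>Both pure second derivatives are nonpositive at an interior maximum. The sign of
  \<open>k\<close> lets maxima and minima be treated together.\<close>

lemma laplacian_sign_at_local_extremum:
  assumes f: "C2_channel L d f" and y: "-d < y" "y < d" and "r > 0"
    and max: "\<And>x' y'. y' \<in> {-d..d} \<Longrightarrow> dist (x', y') (x, y) < r \<Longrightarrow> k * f x' y' \<le> k * f x y"
  shows "k * laplacian d f x y \<le> 0"
proof -
  have hp: "has_partials d f" "has_partials d (dx f)" "has_partials d (dy d f)"
    using f by (auto simp: C2_channel_def C1_strip_def)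
  have "k * dx (dx f) x y \<le> 0"
    by (rule second_derivative_nonpos_at_local_max[OF \<open>r > 0\<close>, of x "\<lambda>s. k * f s y" "\<lambda>s. k * dx f s y"])
      (use y max in \<open>auto intro!: DERIV_cmult has_partials_dx hp
        simp: dist_Pair_Pair dist_real_def abs_minus_commute\<close>)
  moreover have within: "(at s within {-d..d}) = at s" if "-d < s" "s < d" for s :: real
    using that by (simp add: at_within_Icc_at)
  \<comment> \<open>Within this radius the segment derivative is an ordinary two-sided
    derivative.\<close>
  define r' where "r' = min r (min (y + d) (d - y))"
  have "k * dy d (dy d f) x y \<le> 0"
  proof (rule second_derivative_nonpos_at_local_max)
    show "r' > 0" using y \<open>r > 0\<close> by (simp add: r'_def)
    show "k * f x s \<le> k * f x y" if "\<bar>y - s\<bar> < r'" for s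
      using that by (intro max) (auto simp: r'_def dist_Pair_Pair dist_real_def)
    show "((\<lambda>s. k * f x s) has_real_derivative k * dy d f x s) (at s)" if "\<bar>y - s\<bar> < r'" for s
    proof -
      have "-d < s" "s < d" using that by (auto simp: r'_def)
      then show ?thesis
        using has_partials_dy[OF hp(1), of s x] by (intro DERIV_cmult) (simp add: within)
    qed
    show "((\<lambda>s. k * dy d f x s) has_real_derivative k * dy d (dy d f) x y) (at y)"
      using y has_partials_dy[OF hp(3), of y x] by (intro DERIV_cmult) (simp add: within)
  qed
  ultimately show ?thesis by (simp add: laplacian_def distrib_left)
qed

lemma C2_channel_continuous:
  assumes "C2_channel L d f"
  shows "continuous_on (strip d) (\<lambda>z. f (fst z) (snd z))"
    and "continuous_on (strip d) (\<lambda>z. dx f (fst z) (snd z))"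
    and "continuous_on (strip d) (\<lambda>z. dy d f (fst z) (snd z))"
    and "continuous_on (strip d) (\<lambda>z. dx (dx f) (fst z) (snd z))"
    and "continuous_on (strip d) (\<lambda>z. dy d (dy d f) (fst z) (snd z))"
    and "continuous_on (strip d) (\<lambda>z. laplacian d f (fst z) (snd z))"
  using assms C1_strip_continuous unfolding C2_channel_def laplacian_def
  by (auto intro: continuous_on_add)

lemma cbox_subset_strip: "cbox (a, -d) (b, d) \<subseteq> strip d"
  by (auto simp: strip_def cbox_Pair_iff)

lemma continuous_strip_bounded:
  assumes "continuous_on (strip d) (\<lambda>z. f (fst z) (snd z) :: real)"
  obtains M where "\<And>x y. x \<in> {a..b} \<Longrightarrow> y \<in> {-d..d} \<Longrightarrow> \<bar>f x y\<bar> \<le> M"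
proof -
  have "bounded ((\<lambda>z. f (fst z) (snd z)) ` cbox (a, -d) (b, d))"
    by (intro compact_imp_bounded compact_continuous_image
        continuous_on_subset[OF assms cbox_subset_strip] compact_cbox)
  then obtain M where "\<And>z. z \<in> cbox (a, -d) (b, d) \<Longrightarrow> \<bar>f (fst z) (snd z)\<bar> \<le> M"
    by (auto simp: bounded_iff)
  from this[of "(x, y)" for x y] show ?thesis
    by (intro that[of M]) (simp add: cbox_Pair_iff)
qed

text \<open>A positive maximum of \<open>k * v\<close> over the part of one period where
  \<open>u \<ge> c\<close> would be an interior local maximum, so
  \<open>k * laplacian d v \<le> 0\<close> there. The equation with \<open>u > c\<close> and
  \<open>N > 0\<close> gives the opposite sign.\<close>

lemma max_principle_superlevel:
  assumes "L > 0" and u: "C2_channel L d u" and v: "C2_channel L d v"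
    and eq: "\<And>x y. y \<in> {-d..d} \<Longrightarrow> (u x y - c) * laplacian d v x y = v x y * N x y"
    and N: "\<And>x y. y \<in> {-d..d} \<Longrightarrow> N x y > 0"
    and bdry: "\<And>x. v x (-d) = 0 \<and> v x d = 0"
    and y: "y \<in> {-d..d}" and "u x y \<ge> c"
  shows "k * v x y \<le> 0"
proof (rule ccontr)
  assume pos: "\<not> k * v x y \<le> 0"
  have pu: "x_periodic L d u" and pv: "x_periodic L d v"
    using u v by (auto simp: C2_channel_def)
  note cu = C2_channel_continuous(1)[OF u] and cv = C2_channel_continuous(1)[OF v]
  define S where "S = cbox (0, -d) (L, d) \<inter> (\<lambda>z. u (fst z) (snd z)) -` {c..}"
  have S_iff: "(s, t) \<in> S \<longleftrightarrow> s \<in> {0..L} \<and> t \<in> {-d..d} \<and> c \<le> u s t" for s t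
    by (auto simp: S_def cbox_Pair_iff)
  have "closed S"
    unfolding S_def
    by (intro continuous_closed_preimage continuous_on_subset[OF cu cbox_subset_strip]) auto
  then have "compact S"
    by (rule compact_eq_bounded_closed[THEN iffD2, OF conjI, rotated])
      (rule bounded_subset[OF bounded_cbox], auto simp: S_def)
  obtain x1 where x1: "x1 \<in> {0..L}"
    "\<And>f y. x_periodic L d f \<Longrightarrow> y \<in> {-d..d} \<Longrightarrow> f x y = f x1 y"
    by (rule x_periodic_reduce[OF \<open>L > 0\<close>, of d x]) auto
  have x1S: "(x1, y) \<in> S"
    using x1(1) x1(2)[OF pu y] y \<open>u x y \<ge> c\<close> by (simp add: S_iff)
  have "continuous_on S (\<lambda>z. k * v (fst z) (snd z))"
    by (intro continuous_intros continuous_on_subset[OF cv])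
      (auto simp: S_def strip_def cbox_Pair_iff)
  from continuous_attains_sup[OF \<open>compact S\<close> _ this] x1S
  obtain x0 y0 where S0: "(x0, y0) \<in> S"
    and max: "\<And>s t. (s, t) \<in> S \<Longrightarrow> k * v s t \<le> k * v x0 y0"
    by fastforce
  have v0: "k * v x0 y0 > 0"
    using max[OF x1S] x1(2)[OF pv y] pos by simp
  have y0: "y0 \<in> {-d..d}" "c \<le> u x0 y0"
    using S0 by (auto simp: S_iff)
  \<comment> \<open>On the level set \<open>u = c\<close> the equation reads
    \<open>v * N = 0\<close>, so a maximum with \<open>v \<noteq> 0\<close> is not on it.\<close>
  have "u x0 y0 \<noteq> c"
    using eq[OF y0(1), of x0] N[OF y0(1), of x0] v0 by auto
  then have u0: "u x0 y0 > c" using y0 by simp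
  have "y0 \<noteq> -d" "y0 \<noteq> d" using bdry v0 by auto
  then have y0': "-d < y0" "y0 < d" using y0 by auto
  have "(x0, y0) \<in> strip d" using y0 by (simp add: strip_def)
  \<comment> \<open>Near the maximum point \<open>u\<close> stays above \<open>c\<close>, so the
    maximum over \<open>S\<close> is a local maximum in the whole strip.\<close>
  then obtain r where r: "r > 0"
    "\<And>z. z \<in> strip d \<Longrightarrow> dist z (x0, y0) < r \<Longrightarrow> \<bar>u (fst z) (snd z) - u x0 y0\<bar> < u x0 y0 - c"
    using cu u0 unfolding continuous_on_iff dist_real_def
    by (metis diff_gt_0_iff_gt fst_conv snd_conv)
  have "k * laplacian d v x0 y0 \<le> 0"
  proof (rule laplacian_sign_at_local_extremum[OF v y0' \<open>r > 0\<close>])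
    fix s t assume t: "t \<in> {-d..d}" and "dist (s, t) (x0, y0) < r"
    then have "c \<le> u s t"
      using r(2)[of "(s, t)"] by (auto simp: strip_def)
    \<comment> \<open>A neighbour may leave the rectangle through a vertical side; periodicity
      brings it back into \<open>S\<close>.\<close>
    obtain s' where s': "s' \<in> {0..L}"
      "\<And>f y. x_periodic L d f \<Longrightarrow> y \<in> {-d..d} \<Longrightarrow> f s y = f s' y"
      by (rule x_periodic_reduce[OF \<open>L > 0\<close>, of d s]) auto
    have "(s', t) \<in> S"
      using s'(1) s'(2)[OF pu t] t \<open>c \<le> u s t\<close> by (simp add: S_iff)
    then show "k * v s t \<le> k * v x0 y0"
      using max s'(2)[OF pv t] by simp
  qed
  moreover have "(u x0 y0 - c) * (k * laplacian d v x0 y0) = (k * v x0 y0) * N x0 y0"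
    using eq[OF y0(1), of x0] by (simp add: ac_simps)
  then have "(u x0 y0 - c) * (k * laplacian d v x0 y0) > 0"
    using mult_pos_pos[OF v0 N[OF y0(1), of x0]] by (simp only:)
  then have "k * laplacian d v x0 y0 > 0"
    by (rule zero_less_mult_pos) (use u0 in simp)
  ultimately show False by linarith
qed

subsection \<open>The energy identity\<close>

text \<open>The variables are the values of the fields and their derivatives at one point, with
  \<open>Lw\<close> and \<open>Lv\<close> for the Laplacians. The errors are of order
  \<open>\<delta>\<^sup>2\<close> before division by \<open>\<delta>\<close>, and the indefinite
  term is absorbed by the square.\<close>

lemma energy_divergence_lower_bound:
  fixes w v H :: real
  assumes \<delta>: "0 < \<delta>" "\<delta> \<le> 1" and y: "\<bar>y\<bar> \<le> d"
    and M: "\<bar>w\<bar> \<le> M" "\<bar>wx\<bar> \<le> M" "0 \<le> Lw" "Lw \<le> M"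
    and vw: "\<bar>v\<bar> \<le> C * \<bar>w\<bar>" and v0: "w \<ge> 0 \<Longrightarrow> v = 0" and "C \<ge> 0" and "\<beta> \<ge> 0"
    and eq: "w * Lv = v * (Lw - \<beta>)"
    and H: "w < 0 \<Longrightarrow> H = 1 / (\<delta>\<^sup>2 - w)"
  shows "- (C\<^sup>2 * M + d * M * C + (d * M)\<^sup>2) * \<delta>
      \<le> ((vx + v * H * wx)\<^sup>2 + (vy + v * H * wy)\<^sup>2 + v * Lv + v\<^sup>2 * H * Lw) / \<delta>
        + y * (w * vx - v * wx)"
proof -
  define A where "A = vx + v * H * wx"
  have nn: "M \<ge> 0" "d \<ge> 0" using M y by auto
  have e: "\<delta>\<^sup>2 > 0" "\<delta>\<^sup>2 \<le> \<delta>"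
    using \<delta> by (auto simp: power2_eq_square mult_left_le)
  \<comment> \<open>Both errors come from replacing \<open>- 1 / w\<close> by \<open>H\<close>. The
    bound on \<open>v\<close> by \<open>C * \<bar>w\<bar>\<close> compensates the singularity at
    \<open>w = 0\<close>.\<close>
  have core: "v * Lv + v\<^sup>2 * H * Lw \<ge> - (C\<^sup>2 * M * \<delta>\<^sup>2) \<and> \<bar>v * (1 + w * H)\<bar> \<le> C * \<delta>\<^sup>2"
  proof (cases "w < 0")
    case False
    then show ?thesis using v0 nn \<open>C \<ge> 0\<close> by simp
  next
    case True
    define s where "s = - w"
    have s: "s > 0" "\<delta>\<^sup>2 + s > 0" "w = - s" "H = 1 / (\<delta>\<^sup>2 + s)"
      using True H add_pos_pos[OF e(1), of "- w"] by (simp_all add: s_def)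
    have vs: "\<bar>v\<bar> \<le> C * s" using vw s by simp
    have Lv: "Lv = - v * (Lw - \<beta>) / s"
      using eq s by (simp add: field_simps)
    have sle: "s / (\<delta>\<^sup>2 + s) \<le> 1" using s(2) e(1) by (simp add: pos_divide_le_eq del: zero_less_power2)
    have "v\<^sup>2 * Lw \<le> (C * s)\<^sup>2 * M"
      using vs M abs_le_square_iff[of v "C * s"] s \<open>C \<ge> 0\<close> by (intro mult_mono) auto
    then have "v\<^sup>2 * Lw * (\<delta>\<^sup>2 / (s * (\<delta>\<^sup>2 + s))) \<le> (C * s)\<^sup>2 * M * (\<delta>\<^sup>2 / (s * (\<delta>\<^sup>2 + s)))"
      using s e by (intro mult_right_mono) auto
    also have "\<dots> = C\<^sup>2 * M * \<delta>\<^sup>2 * (s / (\<delta>\<^sup>2 + s))"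
      using s by (simp add: power2_eq_square)
    also have "\<dots> \<le> C\<^sup>2 * M * \<delta>\<^sup>2 * 1"
      using nn sle by (intro mult_left_mono) auto
    finally have 1: "v\<^sup>2 * Lw * (\<delta>\<^sup>2 / (s * (\<delta>\<^sup>2 + s))) \<le> C\<^sup>2 * M * \<delta>\<^sup>2" by simp
    \<comment> \<open>The term with \<open>\<beta>\<close> has the favourable sign; only the
      difference of the two reciprocals has to be estimated.\<close>
    have "v * Lv + v\<^sup>2 * H * Lw = v\<^sup>2 * \<beta> / s - v\<^sup>2 * Lw * (1 / s - 1 / (\<delta>\<^sup>2 + s))"
      unfolding Lv s(4) by (simp add: power2_eq_square diff_divide_distrib algebra_simps)
    also have "1 / s - 1 / (\<delta>\<^sup>2 + s) = \<delta>\<^sup>2 / (s * (\<delta>\<^sup>2 + s))"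
      using s by (simp add: divide_simps)
    finally have 2: "v * Lv + v\<^sup>2 * H * Lw \<ge> - (C\<^sup>2 * M * \<delta>\<^sup>2)"
      using 1 s \<open>\<beta> \<ge> 0\<close> by (smt (verit) divide_nonneg_pos mult_nonneg_nonneg zero_le_power2)
    have "1 + w * H = \<delta>\<^sup>2 / (\<delta>\<^sup>2 + s)"
      unfolding s(3,4) using s(2) by (simp add: field_simps)
    then have "\<bar>v * (1 + w * H)\<bar> = \<bar>v\<bar> * (\<delta>\<^sup>2 / (\<delta>\<^sup>2 + s))"
      using s e by (simp add: abs_mult)
    also have "\<dots> \<le> C * s * (\<delta>\<^sup>2 / (\<delta>\<^sup>2 + s))"
      using vs s e by (intro mult_right_mono) auto
    also have "\<dots> = C * \<delta>\<^sup>2 * (s / (\<delta>\<^sup>2 + s))" by simp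
    also have "\<dots> \<le> C * \<delta>\<^sup>2 * 1"
      using \<open>C \<ge> 0\<close> sle by (intro mult_left_mono) auto
    finally show ?thesis using 2 by simp
  qed
  \<comment> \<open>Up to the small factor \<open>v * (1 + w * H)\<close>, this expression is
    \<open>w\<close> times the quantity \<open>A\<close> whose square is available.\<close>
  have "w * vx - v * wx = w * A - v * (1 + w * H) * wx"
    by (simp add: A_def algebra_simps)
  then have "\<bar>y * (w * vx - v * wx)\<bar> = \<bar>y\<bar> * \<bar>w * A - v * (1 + w * H) * wx\<bar>"
    by (simp add: abs_mult)
  also have "\<dots> \<le> d * (M * \<bar>A\<bar> + C * \<delta>\<^sup>2 * M)"
  proof (intro mult_mono y)
    have "\<bar>w * A\<bar> \<le> M * \<bar>A\<bar>" using M by (simp add: abs_mult mult_right_mono)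
    moreover have "\<bar>v * (1 + w * H) * wx\<bar> \<le> C * \<delta>\<^sup>2 * M"
      unfolding abs_mult[of _ wx] using core M nn \<open>C \<ge> 0\<close> by (intro mult_mono) auto
    ultimately show "\<bar>w * A - v * (1 + w * H) * wx\<bar> \<le> M * \<bar>A\<bar> + C * \<delta>\<^sup>2 * M" by linarith
  qed (use nn in auto)
  finally have y1: "y * (w * vx - v * wx) \<ge> - (d * M * \<bar>A\<bar>) - d * M * C * \<delta>\<^sup>2"
    by (simp add: algebra_simps)
  have "d * M * C * \<delta>\<^sup>2 \<le> d * M * C * \<delta>"
    using nn \<open>C \<ge> 0\<close> e by (intro mult_left_mono) auto
  with y1 have y2: "y * (w * vx - v * wx) \<ge> - (d * M * \<bar>A\<bar>) - d * M * C * \<delta>" by linarith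
  \<comment> \<open>A form of Young's inequality: \<open>d * M * \<bar>A\<bar>\<close> is at most
    \<open>A\<^sup>2 / \<delta> + (d * M)\<^sup>2 * \<delta>\<close>.\<close>
  have "0 \<le> (\<bar>A\<bar> - d * M * \<delta>)\<^sup>2 + \<bar>A\<bar> * (d * M * \<delta>)"
    using nn \<delta> by simp
  then have "(d * M * \<bar>A\<bar>) * \<delta> - (d * M)\<^sup>2 * \<delta> * \<delta> \<le> A\<^sup>2"
    by (simp add: power2_eq_square algebra_simps flip: abs_mult)
  then have "d * M * \<bar>A\<bar> - (d * M)\<^sup>2 * \<delta> \<le> A\<^sup>2 / \<delta>"
    using \<delta>(1) by (simp only: pos_le_divide_eq left_diff_distrib)
  moreover have "- (C\<^sup>2 * M * \<delta>\<^sup>2) \<le> (vy + v * H * wy)\<^sup>2 + v * Lv + v\<^sup>2 * H * Lw"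
    using core zero_le_power2[of "vy + v * H * wy"] by linarith
  then have "- (C\<^sup>2 * M * \<delta>) \<le> ((vy + v * H * wy)\<^sup>2 + v * Lv + v\<^sup>2 * H * Lw) / \<delta>"
    using \<delta>(1) by (simp add: pos_le_divide_eq power2_eq_square[of \<delta>] mult.assoc)
  ultimately have "- (C\<^sup>2 * M + d * M * C + (d * M)\<^sup>2) * \<delta>
      \<le> A\<^sup>2 / \<delta> + ((vy + v * H * wy)\<^sup>2 + v * Lv + v\<^sup>2 * H * Lw) / \<delta> + y * (w * vx - v * wx)"
    using y2 by (simp add: algebra_simps)
  then show ?thesis by (simp add: A_def add_divide_distrib)
qed

section \<open>Vanishing of the second velocity component\<close>

lemma v_eq_0_of_laplacian_gt_beta:
  assumes "L > 0" and "d > 0" and "\<beta> \<ge> 0" and "\<gamma> > 0"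
    and u: "C2_channel L d u" and v: "C2_channel L d v"
    and div: "\<And>x y. y \<in> {-d..d} \<Longrightarrow> dx u x y + dy d v x y = 0"
    and eq: "\<And>x y. y \<in> {-d..d} \<Longrightarrow>
               (u x y - c) * laplacian d v x y = v x y * (laplacian d u x y - \<beta>)"
    and bdry: "\<And>x. v x (-d) = 0 \<and> v x d = 0"
    and low: "\<And>x y. y \<in> {-d..d} \<Longrightarrow> \<beta> + \<gamma> \<le> laplacian d u x y"
    and y: "y \<in> {-d..d}"
  shows "v x y = 0"
proof -
  let ?R = "cbox (0, -d) (L, d)"
  have hp: "has_partials d u" "has_partials d (dx u)" "has_partials d (dy d u)"
    "has_partials d v" "has_partials d (dx v)" "has_partials d (dy d v)"
    and pu: "x_periodic L d u" and pv: "x_periodic L d v"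
    using u v by (auto simp: C2_channel_def C1_strip_def)
  note D = hp[THEN has_partials_dx] hp[THEN has_partials_dy]
  note cont = C2_channel_continuous[OF u] C2_channel_continuous[OF v]
  have v0: "v x y = 0" if "y \<in> {-d..d}" "u x y \<ge> c" for x y
  proof -
    have N: "0 < laplacian d u x y - \<beta>" if "y \<in> {-d..d}" for x y
      using low[OF that, of x] \<open>\<gamma> > 0\<close> by simp
    \<comment> \<open>The factors 1 and -1 exclude positive and negative values of \<open>v\<close>
      respectively.\<close>
    show ?thesis
      using max_principle_superlevel[OF \<open>L > 0\<close> u v eq N bdry that, of 1]
        max_principle_superlevel[OF \<open>L > 0\<close> u v eq N bdry that, of "-1"] by simp
  qed
  obtain M1 where M1: "\<And>x y. x \<in> {0..L} \<Longrightarrow> y \<in> {-d..d} \<Longrightarrow> \<bar>u x y - c\<bar> \<le> M1"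
    by (rule continuous_strip_bounded[of d "\<lambda>x y. u x y - c" 0 L])
      (auto intro!: continuous_intros cont)
  obtain M2 where M2: "\<And>x y. x \<in> {0..L} \<Longrightarrow> y \<in> {-d..d} \<Longrightarrow> \<bar>dx u x y\<bar> \<le> M2"
    by (rule continuous_strip_bounded[OF cont(2)]) auto
  obtain M3 where M3: "\<And>x y. x \<in> {0..L} \<Longrightarrow> y \<in> {-d..d} \<Longrightarrow> \<bar>laplacian d u x y\<bar> \<le> M3"
    by (rule continuous_strip_bounded[OF cont(6)]) auto
  obtain M4 where M4: "\<And>x y. x \<in> {0..L} \<Longrightarrow> y \<in> {-d..d} \<Longrightarrow> \<bar>laplacian d v x y\<bar> \<le> M4"
    by (rule continuous_strip_bounded[OF cont(12)]) auto
  define M where "M = max (max M1 M2) (max M3 M4)"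
  \<comment> \<open>Dividing the vorticity equation by
    \<open>laplacian d u - \<beta> \<ge> \<gamma>\<close> bounds \<open>v\<close> by
    \<open>C * \<bar>u - c\<bar>\<close>.\<close>
  define C where "C = M / \<gamma>"
  define K where "K = C\<^sup>2 * M + d * M * C + (d * M)\<^sup>2"
  have "M1 \<ge> 0" using M1[of 0 0] \<open>L > 0\<close> \<open>d > 0\<close> by simp
  then have "M \<ge> 0" by (simp add: M_def)
  then have "C \<ge> 0" using \<open>\<gamma> > 0\<close> by (simp add: C_def)
  have vC: "\<bar>v x y\<bar> \<le> C * \<bar>u x y - c\<bar>" if xy: "x \<in> {0..L}" "y \<in> {-d..d}" for x y
  proof -
    have "\<bar>v x y\<bar> * \<gamma> \<le> \<bar>v x y\<bar> * \<bar>laplacian d u x y - \<beta>\<bar>"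
      using low[OF xy(2), of x] by (intro mult_left_mono) auto
    also have "\<dots> = \<bar>u x y - c\<bar> * \<bar>laplacian d v x y\<bar>"
      using eq[OF xy(2), of x] by (simp flip: abs_mult)
    also have "\<dots> \<le> \<bar>u x y - c\<bar> * M"
      using M4[OF xy] by (intro mult_left_mono) (auto simp: M_def)
    finally show ?thesis using \<open>\<gamma> > 0\<close> by (simp add: C_def field_simps)
  qed
  define I where "I = integral ?R (\<lambda>z. (v (fst z) (snd z))\<^sup>2)"
  have cv2: "continuous_on ?R (\<lambda>z. (v (fst z) (snd z))\<^sup>2)"
    by (intro continuous_intros continuous_on_subset[OF cont(7) cbox_subset_strip])
  have I_le: "I \<le> K * \<delta> * measure lborel ?R" if \<delta>: "0 < \<delta>" "\<delta> \<le> 1" for \<delta>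
  proof -
    have "\<delta>\<^sup>2 > 0" using \<delta> by simp
    obtain H H' where H: "\<And>s. (H has_real_derivative H' s) (at s)" "continuous_on UNIV H'"
      "\<And>s. s \<le> 0 \<Longrightarrow> H s = 1 / (\<delta>\<^sup>2 - s)" "\<And>s. s \<le> 0 \<Longrightarrow> H' s = (H s)\<^sup>2"
      by (rule C1_reciprocal_extension[OF \<open>\<delta>\<^sup>2 > 0\<close>]) blast
    have cH: "continuous_on UNIV H"
      using H(1) DERIV_isCont continuous_at_imp_continuous_on by blast
    let ?w = "\<lambda>x y. u x y - c"
    \<comment> \<open>\<open>(F1, F2)\<close> is \<open>1/\<delta>\<close> times the energy field
      plus the field obtained from incompressibility; \<open>G1\<close> and \<open>G2\<close> are
      the two terms of its divergence.\<close>
    define k where "k = 1 / \<delta>"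
    define F1 where "F1 x y = k * (v x y * dx v x y + (v x y)\<^sup>2 * H (?w x y) * dx u x y)
        + y * ?w x y * v x y" for x y
    define F2 where "F2 x y = k * (v x y * dy d v x y + (v x y)\<^sup>2 * H (?w x y) * dy d u x y)
        + y * (v x y)\<^sup>2" for x y
    define G1 where "G1 x y = k * ((dx v x y)\<^sup>2 + v x y * dx (dx v) x y
        + 2 * v x y * dx v x y * H (?w x y) * dx u x y
        + (v x y)\<^sup>2 * (H' (?w x y) * dx u x y) * dx u x y
        + (v x y)\<^sup>2 * H (?w x y) * dx (dx u) x y)
        + y * (dx u x y * v x y + ?w x y * dx v x y)" for x y
    define G2 where "G2 x y = k * ((dy d v x y)\<^sup>2 + v x y * dy d (dy d v) x y
        + 2 * v x y * dy d v x y * H (?w x y) * dy d u x y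
        + (v x y)\<^sup>2 * (H' (?w x y) * dy d u x y) * dy d u x y
        + (v x y)\<^sup>2 * H (?w x y) * dy d (dy d u) x y)
        + (v x y)\<^sup>2 + 2 * y * v x y * dy d v x y" for x y
    have cHw: "continuous_on (strip d) (\<lambda>z. H (?w (fst z) (snd z)))"
      "continuous_on (strip d) (\<lambda>z. H' (?w (fst z) (snd z)))"
      by (rule continuous_on_compose2[OF cH] continuous_on_compose2[OF H(2)],
          intro continuous_intros cont, simp)+
    have cG: "continuous_on (strip d) (\<lambda>z. G1 (fst z) (snd z))"
      "continuous_on (strip d) (\<lambda>z. G2 (fst z) (snd z))"
      unfolding G1_def G2_def by (intro continuous_intros cont cHw)+
    have G0: "((\<lambda>z. G1 (fst z) (snd z) + G2 (fst z) (snd z)) has_integral 0) ?R"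
    proof (rule integral_divergence_zero[OF \<open>L > 0\<close> \<open>d > 0\<close> _ _ cG, where ?F1.0 = F1 and ?F2.0 = F2])
      fix x y assume y: "y \<in> {-d..d}"
      have "((\<lambda>s. H (?w s y)) has_real_derivative H' (?w x y) * dx u x y) (at x)"
        using y by (intro DERIV_chain2[OF H(1)]) (auto intro!: derivative_eq_intros D)
      then show "((\<lambda>s. F1 s y) has_real_derivative G1 x y) (at x)"
        unfolding F1_def G1_def using y
        by (auto intro!: derivative_eq_intros D simp: power2_eq_square algebra_simps)
      have "((\<lambda>s. H (?w x s)) has_real_derivative H' (?w x y) * dy d u x y) (at y within {-d..d})"
        using y by (intro DERIV_chain2[OF H(1)]) (auto intro!: derivative_eq_intros D)
      then show "(F2 x has_real_derivative G2 x y) (at y within {-d..d})"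
        unfolding F2_def[abs_def] G2_def using y
        by (auto intro!: derivative_eq_intros D simp: power2_eq_square algebra_simps)
    next
      fix y assume y: "y \<in> {-d..d}"
      have per: "f L y = f 0 y" if "x_periodic L d f" for f
        using that y unfolding x_periodic_def by (metis add_0)
      then show "F1 L y = F1 0 y"
        using per[OF pu] per[OF pv] per[OF x_periodic_dx[OF pu]] per[OF x_periodic_dx[OF pv]]
        by (simp add: F1_def)
    next
      show "F2 x (-d) = F2 x d" for x
        using bdry by (simp add: F2_def)
    qed
    have pointwise: "(v x y)\<^sup>2 - K * \<delta> \<le> G1 x y + G2 x y" if xy: "x \<in> {0..L}" "y \<in> {-d..d}" for x y
    proof -
      let ?H = "H (?w x y)"
      \<comment> \<open>\<open>H' = H\<^sup>2\<close> is known only for nonpositive arguments;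
        elsewhere the factor \<open>v\<close> is zero.\<close>
      have sq: "(v x y)\<^sup>2 * H' (?w x y) = (v x y)\<^sup>2 * ?H\<^sup>2"
        using H(4)[of "?w x y"] v0[OF xy(2), of x] by (cases "u x y \<le> c") auto
      \<comment> \<open>The expansion isolates the divergence of the velocity and the defect
        \<open>H' - H\<^sup>2\<close> as separate summands, both of which drop out next.\<close>
      have "G1 x y + G2 x y = k * ((dx v x y + v x y * ?H * dx u x y)\<^sup>2
          + (dy d v x y + v x y * ?H * dy d u x y)\<^sup>2
          + v x y * laplacian d v x y + (v x y)\<^sup>2 * ?H * laplacian d u x y)
          + y * (?w x y * dx v x y + v x y * dy d v x y) + (v x y)\<^sup>2
          + y * v x y * (dx u x y + dy d v x y)
          + k * ((v x y)\<^sup>2 * H' (?w x y) - (v x y)\<^sup>2 * ?H\<^sup>2) * ((dx u x y)\<^sup>2 + (dy d u x y)\<^sup>2)"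
        unfolding G1_def G2_def laplacian_def by algebra
      also have "\<dots> = k * ((dx v x y + v x y * ?H * dx u x y)\<^sup>2
          + (dy d v x y + v x y * ?H * dy d u x y)\<^sup>2
          + v x y * laplacian d v x y + (v x y)\<^sup>2 * ?H * laplacian d u x y)
          + y * (?w x y * dx v x y - v x y * dx u x y) + (v x y)\<^sup>2"
      proof -
        have "dy d v x y = - dx u x y" using div[OF xy(2), of x] by linarith
        then show ?thesis unfolding sq by simp
      qed
      finally have G: "G1 x y + G2 x y = \<dots>" .
      have "- K * \<delta> \<le> ((dx v x y + v x y * ?H * dx u x y)\<^sup>2
          + (dy d v x y + v x y * ?H * dy d u x y)\<^sup>2
          + v x y * laplacian d v x y + (v x y)\<^sup>2 * ?H * laplacian d u x y) / \<delta>
          + y * (?w x y * dx v x y - v x y * dx u x y)"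
        unfolding K_def
      proof (rule energy_divergence_lower_bound[OF \<delta>])
        show "\<bar>y\<bar> \<le> d" using xy by auto
        show "\<bar>?w x y\<bar> \<le> M" "\<bar>dx u x y\<bar> \<le> M" "laplacian d u x y \<le> M"
          using M1[OF xy] M2[OF xy] M3[OF xy] by (auto simp: M_def)
        show "0 \<le> laplacian d u x y"
          using low[OF xy(2), of x] \<open>\<beta> \<ge> 0\<close> \<open>\<gamma> > 0\<close> by linarith
      qed (use xy v0 vC eq H(3) \<open>\<beta> \<ge> 0\<close> \<open>C \<ge> 0\<close> in auto)
      then show ?thesis unfolding G k_def by simp
    qed
    have int: "((\<lambda>z. (v (fst z) (snd z))\<^sup>2 - K * \<delta>) has_integral I - measure lborel ?R *\<^sub>R (K * \<delta>)) ?R"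
      unfolding I_def
      by (intro has_integral_diff integrable_integral integrable_continuous cv2 has_integral_const)
    have "I - measure lborel ?R *\<^sub>R (K * \<delta>) \<le> 0"
    proof (rule has_integral_le[OF int G0])
      fix z assume "z \<in> ?R"
      then have "fst z \<in> {0..L}" "snd z \<in> {-d..d}" by (cases z, simp add: cbox_Pair_iff)+
      then show "(v (fst z) (snd z))\<^sup>2 - K * \<delta> \<le> G1 (fst z) (snd z) + G2 (fst z) (snd z)"
        by (rule pointwise)
    qed
    then show ?thesis by (simp add: mult.commute)
  qed
  \<comment> \<open>\<open>I\<close> does not depend on \<open>\<delta>\<close>, so the bounds for
    all small \<open>\<delta>\<close> force it to be zero.\<close>
  have "((\<lambda>\<delta>. K * \<delta> * measure lborel ?R) \<longlongrightarrow> K * 0 * measure lborel ?R) (at_right 0)"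
    by (intro tendsto_intros)
  then have "I \<le> K * 0 * measure lborel ?R"
    by (rule tendsto_lowerbound)
      (use I_le in \<open>auto intro!: eventually_at_rightI[of 0 1]\<close>)
  moreover have "I \<ge> 0" unfolding I_def
    by (intro integral_nonneg integrable_continuous cv2) simp
  ultimately have "((\<lambda>z. (v (fst z) (snd z))\<^sup>2) has_integral 0) ?R"
    using integrable_integral[OF integrable_continuous[OF cv2]] by (simp add: I_def)
  moreover obtain x' where x': "x' \<in> {0..L}"
    "\<And>f y. x_periodic L d f \<Longrightarrow> y \<in> {-d..d} \<Longrightarrow> f x y = f x' y"
    by (rule x_periodic_reduce[OF \<open>L > 0\<close>, of d x]) auto
  \<comment> \<open>A continuous nonnegative function with zero integral vanishes on the whole
    closed rectangle, walls included.\<close>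
  ultimately have "(v x' y)\<^sup>2 = 0"
    using has_integral_0_cbox_imp_0[OF cv2, of "(x', y)"] y \<open>L > 0\<close> \<open>d > 0\<close>
    by (auto simp: cbox_Pair_iff box_ne_empty Basis_prod_def)
  then show ?thesis
    using x'(2)[OF pv y] by simp
qed

section \<open>From the norm hypothesis to a pointwise lower bound on the Laplacian\<close>

theorem proposition6p5:
  fixes L d \<beta> c :: real
    and u\<^sub>0 :: "real \<Rightarrow> real"
    and u v :: "real \<Rightarrow> real \<Rightarrow> real"
  assumes "L > 0" and "d > 0"
    and "C2_seg d u\<^sub>0"
    and "seg_min d (deriv_seg d (deriv_seg d u\<^sub>0)) > 0"
    and "0 \<le> \<beta>" and "\<beta> < seg_min d (deriv_seg d (deriv_seg d u\<^sub>0))"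
    and "C2_channel L d u" and "C2_channel L d v"
    and "beta_plane_solution L d \<beta> (traveling c u) (traveling c v)"
    and "C0_norm d (\<lambda>x y. laplacian d u x y - deriv_seg d (deriv_seg d u\<^sub>0) y)
           < seg_min d (deriv_seg d (deriv_seg d u\<^sub>0)) - \<beta>"
  shows "shear_flow d (traveling c u) (traveling c v)"
proof -
  define g where "g = deriv_seg d (deriv_seg d u\<^sub>0)"
  define E where "E = C0_norm d (\<lambda>x y. laplacian d u x y - g y)"
  note u = \<open>C2_channel L d u\<close> and v = \<open>C2_channel L d v\<close>
  have cg: "continuous_on {-d..d} g"
    using assms(3) by (simp add: C2_seg_def g_def)
  have g_min: "seg_min d g \<le> g y" if "y \<in> {-d..d}" for y
    unfolding seg_min_def using that
    by (intro cINF_lower bounded_imp_bdd_below compact_imp_bounded compact_continuous_image cg) auto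
  have "continuous_on (strip d) (\<lambda>z. g (snd z))"
    by (rule continuous_on_compose2[OF cg]) (auto intro!: continuous_intros simp: strip_def)
  then have "continuous_on (strip d) (\<lambda>z. laplacian d u (fst z) (snd z) - g (snd z))"
    by (intro continuous_intros C2_channel_continuous(6)[OF u])
  then obtain M where M:
    "\<And>x y. x \<in> {0..L} \<Longrightarrow> y \<in> {-d..d} \<Longrightarrow> \<bar>laplacian d u x y - g y\<bar> \<le> M"
    by (rule continuous_strip_bounded[of d "\<lambda>x y. laplacian d u x y - g y" 0 L]) auto
  have hp: "has_partials d u" "has_partials d (dy d u)" and pu: "x_periodic L d u"
    using u by (auto simp: C2_channel_def C1_strip_def)
  have "x_periodic L d (dx (dx u))" "x_periodic L d (dy d (dy d u))"
    using pu hp \<open>d > 0\<close> by (auto intro!: x_periodic_dx x_periodic_dy)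
  then have pl: "x_periodic L d (laplacian d u)"
    by (simp add: x_periodic_def laplacian_def)
  \<comment> \<open>The bound on one period extends to the unbounded strip. This makes the supremum
    in \<open>C0_norm\<close> a genuine upper bound.\<close>
  have "\<bar>laplacian d u x y - g y\<bar> \<le> M" if "y \<in> {-d..d}" for x y
  proof -
    obtain x' where x': "x' \<in> {0..L}"
      "\<And>f y. x_periodic L d f \<Longrightarrow> y \<in> {-d..d} \<Longrightarrow> f x y = f x' y"
      by (rule x_periodic_reduce[OF \<open>L > 0\<close>, of d x]) auto
    then show ?thesis using M[OF x'(1) that] x'(2)[OF pl that] by simp
  qed
  then have "bdd_above ((\<lambda>(x, y). \<bar>laplacian d u x y - g y\<bar>) ` strip d)"
    by (intro bdd_aboveI2[where M = M]) (auto simp: strip_def)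
  then have E_ge: "\<bar>laplacian d u x y - g y\<bar> \<le> E" if "y \<in> {-d..d}" for x y
    using cSUP_upper[of "(x, y)" "strip d" "\<lambda>(x, y). \<bar>laplacian d u x y - g y\<bar>"] that
    by (auto simp: E_def C0_norm_def strip_def)
  \<comment> \<open>This gap serves as \<open>\<gamma>\<close>: the Laplacian is at least
    \<open>seg_min d g - E\<close> everywhere.\<close>
  have "seg_min d g - \<beta> - E > 0"
    using assms(10) by (simp add: g_def E_def)
  moreover have "\<beta> + (seg_min d g - \<beta> - E) \<le> laplacian d u x y" if "y \<in> {-d..d}" for x y
    using E_ge[OF that, of x] g_min[OF that] by linarith
  ultimately have "v x y = 0" if "y \<in> {-d..d}" for x y
    using v_eq_0_of_laplacian_gt_beta[OF \<open>L > 0\<close> \<open>d > 0\<close> \<open>0 \<le> \<beta>\<close> _ u v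
        traveling_wave_vorticity[OF \<open>d > 0\<close> u v assms(9)] _ that]
    by blast
  then show ?thesis
    by (simp add: shear_flow_def traveling_def)
qed

end
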